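(* Let $N,d\ge1$ be integers, let $\gamma,T>0$, and let $U\colon(\mathbb{R}^d)^N\to[0,+\infty]$ be an admissible potential. For every $b\in(0,\tfrac1T)$ there exists $W\in C^\infty(\mathcal{X};(0,\infty))$ satisfying the following two properties: (1) As $H(q,p)\to\infty$ with $(q,p)\in\mathcal{X}$, $$W(q,p)=\exp\big(b\,H(q,p)(1+o(1))\big);$$ in particular, $W(q,p)\to\infty$ as $H(q,p)\to\infty$, $(q,p)\in\mathcal{X}$. (2) There exist constants $c,K>0$ such that $$\mathcal{L}W(q,p)\le -c\,W(q,p)+K\qquad\text{for all }(q,p)\in\mathcal{X}.$$
   Context: Admissible potential: a function $U\colon(\mathbb{R}^d)^N\to[0,+\infty]$ such that, with $\mathcal{O}=\{q\in(\mathbb{R}^d)^N: U(q)<\infty\}$: (i) $\int_{\mathcal{O}}e^{-U(q)/T}\,dq<\infty$; (ii) $U\in C^\infty(\mathcal{O})$; (iii) $\mathcal{O}$ is open and path connected, and for each $R>0$ the set $\{q\in(\mathbb{R}^d)^N: U(q)<R\}$ is open and has compact closure in $(\mathbb{R}^d)^N$; (iv) for any sequence $\{q_k\}\subseteq\mathcal{O}$ with $U(q_k)\to\infty$, one has $|\nabla U(q_k)|\to\infty$ and $|\nabla^2U(q_k)|/|\nabla U(q_k)|^2\to 0$, where $\nabla^2$ denotes the Hessian. The state space is $\mathcal{X}=\mathcal{O}\times(\mathbb{R}^d)^N$ with points $(q,p)$, and $H(q,p)=\frac{|p|^2}{2}+U(q)$. The operator $\mathcal{L}$ is $$\mathcal{L}=p\cdot\nabla_q-\nabla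 U(q)\cdot\nabla_p-\gamma p\cdot\nabla_p+\gamma T\Delta_p,$$ the generator of the Langevin equation $dq=p\,dt$, $dp=[-\gamma p-\nabla U(q)]\,dt+\sqrt{2\gamma T}\,dB(t)$ with $B$ a standard Brownian motion on $(\mathbb{R}^d)^N$. The asymptotic relation in (1) means: for every $\varepsilon>0$ there is $R>0$ such that $\big|\log W(q,p)-bH(q,p)\big|\le\varepsilon H(q,p)$ for all $(q,p)\in\mathcal{X}$ with $H(q,p)\ge R$. *)

theory Defs
  imports "HOL-Analysis.Analysis"
begin

(* Intended for open S only: all derivatives are taken in the full space. *)
primrec Ck_on :: "nat \<Rightarrow> 'a::euclidean_space set \<Rightarrow> ('a \<Rightarrow> real) \<Rightarrow> bool" where
  "Ck_on 0 S f \<longleftrightarrow> continuous_on S f"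
| "Ck_on (Suc k) S f \<longleftrightarrow>
     (\<forall>x\<in>S. f differentiable (at x)) \<and>
     (\<forall>v. Ck_on k S (\<lambda>x. frechet_derivative f (at x) v))"

definition smooth_on :: "'a::euclidean_space set \<Rightarrow> ('a \<Rightarrow> real) \<Rightarrow> bool" where
  "smooth_on S f \<longleftrightarrow> (\<forall>k. Ck_on k S f)"

definition grad :: "('a::euclidean_space \<Rightarrow> real) \<Rightarrow> 'a \<Rightarrow> 'a" where
  "grad f x = (\<Sum>i\<in>Basis. frechet_derivative f (at x) i *\<^sub>R i)"

lemma GDERIV_grad:
  assumes "f differentiable (at x)"
  shows "GDERIV f x :> grad f x"
proof -
  let ?D = "frechet_derivative f (at x)"
  have D: "(f has_derivative ?D) (at x)"
    using assms frechet_derivative_works by blast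
  have "?D = (\<lambda>h. h \<bullet> grad f x)"
  proof
    fix h
    have "?D h = ?D (\<Sum>i\<in>Basis. (h \<bullet> i) *\<^sub>R i)"
      by (simp add: euclidean_representation)
    also have "\<dots> = (\<Sum>i\<in>Basis. (h \<bullet> i) * ?D i)"
      using has_derivative_linear[OF D] by (simp add: linear_sum linear_scale)
    finally show "?D h = h \<bullet> grad f x"
      by (simp add: grad_def inner_sum_right mult.commute)
  qed
  with D show ?thesis by (simp add: gderiv_def)
qed

(* The Hessian as the linear map given by the derivative of the gradient. *)
definition hessian :: "('a::euclidean_space \<Rightarrow> real) \<Rightarrow> 'a \<Rightarrow> 'a \<Rightarrow> 'a" where
  "hessian f x = frechet_derivative (grad f) (at x)"

definition laplacian :: "('a::euclidean_space \<Rightarrow> real) \<Rightarrow> 'a \<Rightarrow> real" where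
  "laplacian f x =
     (\<Sum>i\<in>Basis. frechet_derivative (\<lambda>y. frechet_derivative f (at y) i) (at x) i)"

definition finite_domain :: "('a \<Rightarrow> ennreal) \<Rightarrow> 'a set" where
  "finite_domain U = {q. U q < \<infinity>}"

(* The potential as a real-valued function; meaningful on finite_domain U only
   (its value elsewhere is 0). *)
definition real_potential :: "('a \<Rightarrow> ennreal) \<Rightarrow> 'a \<Rightarrow> real" where
  "real_potential U q = enn2real (U q)"

(* The norm of the Hessian is the operator norm; all norms being equivalent,
   the last condition does not depend on this choice. *)
definition admissible_potential :: "real \<Rightarrow> ('a::euclidean_space \<Rightarrow> ennreal) \<Rightarrow> bool" where
  "admissible_potential T U \<longleftrightarrow>
     (\<integral>\<^sup>+ q\<in>finite_domain U. ennreal (exp (- real_potential U q / T)) \<partial>lborel) < \<infinity> \<and>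
     smooth_on (finite_domain U) (real_potential U) \<and>
     open (finite_domain U) \<and> path_connected (finite_domain U) \<and>
     (\<forall>R>0. open {q. U q < ennreal R} \<and> compact (closure {q. U q < ennreal R})) \<and>
     (\<forall>x :: nat \<Rightarrow> 'a. (\<forall>k. x k \<in> finite_domain U) \<longrightarrow> (\<lambda>k. U (x k)) \<longlonglongrightarrow> \<infinity> \<longrightarrow>
        filterlim (\<lambda>k. norm (grad (real_potential U) (x k))) at_top sequentially \<and>
        (\<lambda>k. onorm (hessian (real_potential U) (x k)) /
              (norm (grad (real_potential U) (x k)))\<^sup>2) \<longlonglongrightarrow> 0)"

definition state_space :: "('a \<Rightarrow> ennreal) \<Rightarrow> ('a \<times> 'a) set" where
  "state_space U = finite_domain U \<times> UNIV"

definition hamiltonian :: "('a::euclidean_space \<Rightarrow> ennreal) \<Rightarrow> 'a \<times> 'a \<Rightarrow> real" where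
  "hamiltonian U = (\<lambda>(q, p). (norm p)\<^sup>2 / 2 + real_potential U q)"

definition langevin_generator ::
    "real \<Rightarrow> real \<Rightarrow> ('a::euclidean_space \<Rightarrow> ennreal) \<Rightarrow> ('a \<times> 'a \<Rightarrow> real) \<Rightarrow> 'a \<times> 'a \<Rightarrow> real" where
  "langevin_generator \<gamma> T U W = (\<lambda>(q, p).
     p \<bullet> grad (\<lambda>q'. W (q', p)) q
     - grad (real_potential U) q \<bullet> grad (\<lambda>p'. W (q, p')) p
     - \<gamma> * (p \<bullet> grad (\<lambda>p'. W (q, p')) p)
     + \<gamma> * T * laplacian (\<lambda>p'. W (q, p')) p)"

end

theory Submission
  imports Defs
begin

text \<open>Write \<open>u\<close> for the potential, \<open>H = |p|\<^sup>2 / 2 + u q\<close>, \<open>L\<close> for the generator and \<open>m\<close> for the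
  dimension of the space of positions. The Lyapunov function is \<open>W = exp V\<close> with
  \<open>V = b H + \<phi> (u q) (p \<bullet> grad u) / |grad u|\<^sup>2\<close>, where \<open>\<phi>\<close> is a smooth cutoff which vanishes up to
  some level and then increases slowly to a constant \<open>\<alpha>\<close>.

  For \<open>W = exp (b H)\<close> alone, \<open>L W / W = - \<gamma> b (1 - b T) |p|\<^sup>2 + \<gamma> T b m\<close>. This is negative for large
  momenta since \<open>b T < 1\<close>, but not when \<open>p\<close> is small and \<open>u q\<close> is large. The correction to \<open>b H\<close>
  repairs this: the term \<open>- grad u \<bullet> \<nabla>\<^sub>p\<close> of \<open>L\<close> applied to it gives exactly \<open>- \<phi> (u q)\<close>, and
  \<open>\<alpha> > \<gamma> T b m\<close>. The other terms produced by the correction are small. Its gradient in \<open>p\<close> has norm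
  at most \<open>\<alpha> / |grad u|\<close>, its derivative in \<open>q\<close> along \<open>p\<close> is at most
  \<open>(|\<phi>'| + 3 \<alpha> |Hess u| / |grad u|\<^sup>2) |p|\<^sup>2\<close>, and by admissibility both \<open>1 / |grad u|\<close> and
  \<open>|Hess u| / |grad u|\<^sup>2\<close> are as small as desired above a high level of \<open>u\<close>, below
  which the correction vanishes (\<open>admissible_potential_threshold\<close>, \<open>has_derivative_corrector\<close>,
  \<open>drift_estimate\<close>). So \<open>L W \<le> - W\<close> whenever \<open>p\<close> or \<open>u q\<close> is large; otherwise \<open>W\<close> and \<open>L W / W\<close> are
  bounded above.

  Finally, the correction is at most \<open>|p|\<close> in absolute value, which is negligible compared to \<open>H\<close>
  (\<open>momentum_negligible\<close>). This gives the asymptotics of \<open>ln W\<close>.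

  The cutoff has to vanish identically below a level: admissibility says nothing on the derivatives
  of \<open>u\<close> where \<open>u\<close> is bounded, not even near the boundary of its domain.\<close>

section \<open>Calculus of \<open>C\<^sup>k\<close> functions on open sets\<close>

lemma Ck_on_cong:
  assumes "open S" "\<And>x. x \<in> S \<Longrightarrow> f x = g x"
  shows "Ck_on k S f \<longleftrightarrow> Ck_on k S g"
proof -
  have "Ck_on k S g" if "Ck_on k S f" "\<And>x. x \<in> S \<Longrightarrow> f x = g x" for f g
    using that
  proof (induction k arbitrary: f g)
    case 0
    then show ?case by (simp cong: continuous_on_cong)
  next
    case (Suc k)
    have D: "(g has_derivative frechet_derivative f (at x)) (at x)" if "x \<in> S" for x
      using Suc.prems that \<open>open S\<close>
      by (intro has_derivative_transform_within_open[of f _ x UNIV S g])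
         (auto simp: frechet_derivative_works)
    then have "frechet_derivative g (at x) = frechet_derivative f (at x)" if "x \<in> S" for x
      using that frechet_derivative_at by metis
    then have "Ck_on k S (\<lambda>x. frechet_derivative g (at x) v)" for v
      using Suc.IH[of "\<lambda>x. frechet_derivative f (at x) v" "\<lambda>x. frechet_derivative g (at x) v"]
        Suc.prems(1) by simp
    with D show ?case by (auto simp: differentiable_def)
  qed
  with assms(2) show ?thesis by metis
qed

lemma Ck_on_subset: "Ck_on k S f \<Longrightarrow> S' \<subseteq> S \<Longrightarrow> Ck_on k S' f"
  by (induction k arbitrary: f) (auto intro: continuous_on_subset)

lemma Ck_on_open_Un:
  assumes "open S" "open S'" "Ck_on k S f" "Ck_on k S' f"
  shows "Ck_on k (S \<union> S') f"
  using assms(3,4)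
  by (induction k arbitrary: f) (auto simp: continuous_on_open_Un assms(1,2))

lemma Ck_on_Suc_imp: "Ck_on (Suc k) S f \<Longrightarrow> Ck_on k S f"
proof (induction k arbitrary: f)
  case 0
  then show ?case
    by (auto intro!: continuous_at_imp_continuous_on differentiable_imp_continuous_within)
next
  case (Suc k)
  then show ?case by simp
qed

text \<open>A function is \<open>C\<^sup>k\<^sup>+\<^sup>1\<close> if it has a derivative which is \<open>C\<^sup>k\<close> in each fixed direction.\<close>

lemma Ck_on_SucI:
  assumes "open S"
    and "\<And>x. x \<in> S \<Longrightarrow> (f has_derivative D x) (at x)"
    and "\<And>v. Ck_on k S (\<lambda>x. D x v)"
  shows "Ck_on (Suc k) S f"
proof -
  have "frechet_derivative f (at x) = D x" if "x \<in> S" for x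
    using assms(2)[OF that] frechet_derivative_at by metis
  then have "Ck_on k S (\<lambda>x. frechet_derivative f (at x) v)" for v
    using Ck_on_cong[OF assms(1), of "\<lambda>x. frechet_derivative f (at x) v" "\<lambda>x. D x v"] assms(3) by simp
  with assms(2) show ?thesis by (auto simp: differentiable_def)
qed

lemma Ck_on_SucD:
  assumes "Ck_on (Suc k) S f"
  shows "x \<in> S \<Longrightarrow> (f has_derivative frechet_derivative f (at x)) (at x)"
    and "Ck_on k S (\<lambda>x. frechet_derivative f (at x) v)"
  using assms by (auto simp: frechet_derivative_works)

lemma Ck_on_const: "open S \<Longrightarrow> Ck_on k S (\<lambda>x. c)"
proof (induction k arbitrary: c)
  case (Suc k)
  then show ?case
    by (auto intro: Ck_on_SucI[where D = "\<lambda>x v. 0"])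
qed simp

lemma Ck_on_linear:
  assumes "open S" "bounded_linear f"
  shows "Ck_on k S f"
proof (cases k)
  case 0
  with assms show ?thesis by (simp add: linear_continuous_on)
next
  case (Suc j)
  show ?thesis unfolding Suc
    by (rule Ck_on_SucI[where D = "\<lambda>x. f"])
       (use assms in \<open>auto intro: bounded_linear_imp_has_derivative Ck_on_const\<close>)
qed

lemma Ck_on_add:
  assumes "open S" "Ck_on k S f" "Ck_on k S g"
  shows "Ck_on k S (\<lambda>x. f x + g x)"
  using assms(2,3)
proof (induction k arbitrary: f g)
  case 0
  then show ?case by (auto intro: continuous_on_add)
next
  case (Suc k)
  show ?case
    by (rule Ck_on_SucI[OF \<open>open S\<close> has_derivative_add
          [OF Ck_on_SucD(1)[OF Suc.prems(1)] Ck_on_SucD(1)[OF Suc.prems(2)]]])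
       (assumption | rule Suc.IH Ck_on_SucD(2)[OF Suc.prems(1)] Ck_on_SucD(2)[OF Suc.prems(2)])+
qed

lemma Ck_on_mult:
  assumes "open S" "Ck_on k S f" "Ck_on k S g"
  shows "Ck_on k S (\<lambda>x. f x * g x)"
  using assms(2,3)
proof (induction k arbitrary: f g)
  case 0
  then show ?case by (auto intro: continuous_on_mult)
next
  case (Suc k)
  show ?case
    by (rule Ck_on_SucI[OF \<open>open S\<close> has_derivative_mult
          [OF Ck_on_SucD(1)[OF Suc.prems(1)] Ck_on_SucD(1)[OF Suc.prems(2)]]])
       (assumption | rule Ck_on_add \<open>open S\<close> Suc.IH Ck_on_SucD(2)[OF Suc.prems(1)]
          Ck_on_SucD(2)[OF Suc.prems(2)] Ck_on_Suc_imp[OF Suc.prems(1)] Ck_on_Suc_imp[OF Suc.prems(2)])+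
qed

lemma Ck_on_sum:
  assumes "open S" "\<And>i. i \<in> I \<Longrightarrow> Ck_on k S (f i)"
  shows "Ck_on k S (\<lambda>x. \<Sum>i\<in>I. f i x)"
  using assms(2)
  by (induction I rule: infinite_finite_induct)
     (auto intro!: Ck_on_const Ck_on_add assms(1))

lemma Ck_on_compose_linear:
  assumes "open S" "open S'" "bounded_linear L" "\<And>x. x \<in> S' \<Longrightarrow> L x \<in> S" "Ck_on k S f"
  shows "Ck_on k S' (\<lambda>x. f (L x))"
  using assms(5)
proof (induction k arbitrary: f)
  case 0
  then have "continuous_on (L ` S') f"
    using assms(4) by (auto intro: continuous_on_subset)
  then show ?case
    using continuous_on_compose[of S' L f] linear_continuous_on[OF assms(3)] by (simp add: o_def)
next
  case (Suc k)
  have "((\<lambda>x. f (L x)) has_derivative (\<lambda>v. frechet_derivative f (at (L x)) (L v))) (at x)"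
    if "x \<in> S'" for x
    by (rule has_derivative_compose[OF bounded_linear_imp_has_derivative[OF assms(3)]
          Ck_on_SucD(1)[OF Suc.prems assms(4)[OF that]]])
  moreover have "Ck_on k S' (\<lambda>x. frechet_derivative f (at (L x)) (L v))" for v
    by (rule Suc.IH[OF Ck_on_SucD(2)[OF Suc.prems]])
  ultimately show ?case
    by (rule Ck_on_SucI[OF assms(2)])
qed

lemma Ck_on_compose_real:
  fixes g :: "real \<Rightarrow> real"
  assumes "open S" "open T" "\<And>x. x \<in> S \<Longrightarrow> f x \<in> T" "Ck_on k T g" "Ck_on k S f"
  shows "Ck_on k S (\<lambda>x. g (f x))"
  using assms(4,5)
proof (induction k arbitrary: g)
  case 0
  then have "continuous_on (f ` S) g"
    using assms(3) by (auto intro: continuous_on_subset)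
  then show ?case
    using continuous_on_compose[of S f g] 0 by (simp add: o_def)
next
  case (Suc k)
  define g' where "g' t = frechet_derivative g (at t) 1" for t
  have g': "(g has_derivative (\<lambda>h. g' t * h)) (at t)" if "t \<in> T" for t
  proof -
    have D: "(g has_derivative frechet_derivative g (at t)) (at t)"
      using Ck_on_SucD(1)[OF Suc.prems(1) that] .
    have "frechet_derivative g (at t) h = g' t * h" for h
      using linear_scale[OF has_derivative_linear[OF D], of h 1] by (simp add: g'_def)
    then have "frechet_derivative g (at t) = (\<lambda>h. g' t * h)" by (rule ext)
    with D show ?thesis by simp
  qed
  have "((\<lambda>x. g (f x)) has_derivative (\<lambda>v. g' (f x) * frechet_derivative f (at x) v)) (at x)"
    if "x \<in> S" for x
    by (rule has_derivative_compose[OF Ck_on_SucD(1)[OF Suc.prems(2) that] g'[OF assms(3)[OF that]]])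
  then show ?case
  proof (rule Ck_on_SucI[OF assms(1)])
    show "Ck_on k S (\<lambda>x. g' (f x) * frechet_derivative f (at x) v)" for v
      using Suc.IH[of g'] Ck_on_SucD(2)[OF Suc.prems(1)] Ck_on_Suc_imp[OF Suc.prems(2)]
        Ck_on_SucD(2)[OF Suc.prems(2)] by (auto simp: g'_def intro!: Ck_on_mult assms(1))
  qed
qed

lemma Ck_on_exp: "Ck_on k UNIV (exp :: real \<Rightarrow> real)"
proof (induction k)
  case 0
  show ?case by (auto intro!: continuous_intros)
next
  case (Suc k)
  have "(exp has_derivative (\<lambda>v. exp x * v)) (at x)" for x :: real
    using DERIV_exp[of x] by (simp add: has_field_derivative_def)
  then show ?case
    by (rule Ck_on_SucI[OF open_UNIV]) (intro Ck_on_mult Ck_on_const Suc.IH open_UNIV)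
qed

lemma Ck_on_inverse: "Ck_on k (- {0}) (inverse :: real \<Rightarrow> real)"
proof (induction k)
  case 0
  show ?case by (auto intro!: continuous_intros)
next
  case (Suc k)
  have "(inverse has_derivative (\<lambda>v. (- 1 * (inverse x * inverse x)) * v)) (at x)"
    if "x \<in> - {0}" for x :: real
    by (rule has_derivative_eq_rhs[OF DERIV_inverse[unfolded has_field_derivative_def]])
       (use that in \<open>auto simp: fun_eq_iff power2_eq_square\<close>)
  then show ?case
    by (rule Ck_on_SucI[OF open_Compl[OF closed_singleton]])
       (assumption | rule Ck_on_mult Ck_on_const Suc.IH open_Compl closed_singleton)+
qed

section \<open>A flat function\<close>

text \<open>The family \<open>exp (- 1 / t) / t ^ n\<close>, extended by zero to \<open>t \<le> 0\<close>. Differentiation maps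
  it into its own linear span, so its members are smooth on the whole line. The member with
  \<open>n = 0\<close> increases from \<open>0\<close> towards \<open>1\<close> and is used as a cutoff.\<close>

definition flat :: "nat \<Rightarrow> real \<Rightarrow> real" where
  "flat n t = (if t > 0 then exp (- inverse t) / t ^ n else 0)"

lemma flat_nonneg: "flat n t \<ge> 0"
  by (simp add: flat_def)

lemma power_le_fact_exp:
  fixes x :: real
  assumes "x \<ge> 0"
  shows "x ^ n \<le> fact n * exp x"
proof -
  have "x ^ n / fact n \<le> (\<Sum>k. x ^ k / fact k)"
    using sum_le_suminf[of "\<lambda>k. x ^ k / fact k" "{n}"] summable_exp[of x] assms
    by (simp add: divide_inverse mult.commute)
  also have "\<dots> = exp x"
    by (simp add: exp_def divide_inverse mult.commute)
  finally show ?thesis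
    by (simp add: pos_divide_le_eq mult.commute)
qed

lemma flat_le:
  assumes "t \<ge> 0"
  shows "flat n t \<le> fact (n + k) * t ^ k"
proof (cases "t = 0")
  case True
  then show ?thesis by (simp add: flat_def)
next
  case False
  with assms have t: "t > 0" by simp
  have "flat n t = inverse t ^ (n + k) * exp (- inverse t) * t ^ k"
    using t by (simp add: flat_def power_add power_inverse divide_inverse)
  also have "\<dots> \<le> fact (n + k) * exp (inverse t) * exp (- inverse t) * t ^ k"
    using power_le_fact_exp[of "inverse t" "n + k"] t by (intro mult_right_mono) auto
  also have "\<dots> = fact (n + k) * t ^ k"
    by (simp add: exp_minus)
  finally show ?thesis .
qed

lemma DERIV_flat:
  "(flat n has_real_derivative flat (n + 2) t - real n * flat (Suc n) t) (at t)"
proof -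
  consider "t < 0" | "t = 0" | "t > 0" by linarith
  then show ?thesis
  proof cases
    case 1
    have "(flat n has_real_derivative 0) (at t)"
      by (rule has_field_derivative_transform_within_open[OF DERIV_const, of "{..<0}"])
         (use 1 in \<open>auto simp: flat_def\<close>)
    with 1 show ?thesis by (simp add: flat_def)
  next
    case 2
    obtain c :: real where c: "c \<ge> 0" "\<And>h. h \<ge> 0 \<Longrightarrow> flat n h \<le> c * h\<^sup>2"
      using flat_le[of _ n 2] fact_ge_zero by blast
    have "norm (flat n h / h) \<le> c * \<bar>h\<bar>" for h
    proof (cases "h > 0")
      case True
      then show ?thesis
        using c(2)[of h] flat_nonneg[of n h] by (simp add: field_simps power2_eq_square)
    next
      case False
      with c(1) show ?thesis by (simp add: flat_def mult_nonneg_nonpos)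
    qed
    then have "\<forall>\<^sub>F h in at 0. norm (flat n h / h) \<le> c * \<bar>h\<bar>"
      by (intro always_eventually allI)
    moreover have "((\<lambda>h. c * \<bar>h\<bar>) \<longlongrightarrow> 0) (at 0)"
      by (intro tendsto_mult_right_zero tendsto_rabs_zero tendsto_ident_at)
    ultimately have "((\<lambda>h. flat n h / h) \<longlongrightarrow> 0) (at 0)"
      by (rule Lim_null_comparison)
    then have "(flat n has_real_derivative 0) (at 0)"
      by (simp add: DERIV_def flat_def)
    with 2 show ?thesis by (simp add: flat_def)
  next
    case 3
    have "((\<lambda>t. exp (- inverse t) / t ^ n) has_real_derivative
        (flat (n + 2) t - real n * flat (Suc n) t)) (at t)"
    proof (rule DERIV_cong[OF DERIV_divide[OF DERIV_fun_exp[OF DERIV_minus[OF DERIV_inverse]] DERIV_pow]])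
      show "t \<noteq> 0" "t ^ n \<noteq> 0" using 3 by auto
      show "(exp (- inverse t) * - (- (inverse t ^ Suc (Suc 0))) * t ^ n
            - exp (- inverse t) * (real n * t ^ (n - Suc 0))) / (t ^ n * t ^ n) =
          flat (n + 2) t - real n * flat (Suc n) t"
        using 3 by (cases n) (simp_all add: flat_def field_simps)
    qed
    then show ?thesis
      by (rule has_field_derivative_transform_within_open[of _ _ _ "{0<..}"])
         (use 3 in \<open>auto simp: flat_def\<close>)
  qed
qed

lemma Ck_on_flat: "Ck_on k UNIV (flat n)"
proof (induction k arbitrary: n)
  case 0
  show ?case
    using DERIV_isCont[OF DERIV_flat] by (simp add: continuous_at_imp_continuous_on)
next
  case (Suc k)
  have "(flat n has_derivative (\<lambda>h. (flat (n + 2) t + - real n * flat (Suc n) t) * h)) (at t)" for t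
    using DERIV_flat[of n t] by (simp add: has_field_derivative_def)
  then show ?case
    by (rule Ck_on_SucI[OF open_UNIV])
       (rule Ck_on_mult Ck_on_add Ck_on_const Suc.IH open_UNIV)+
qed

section \<open>Gradients, Hessians and the generator\<close>

lemma has_derivative_grad:
  assumes "f differentiable (at x)"
  shows "(f has_derivative (\<lambda>h. h \<bullet> grad f x)) (at x)"
  using GDERIV_grad[OF assms] by (simp add: gderiv_def)

lemma inner_grad:
  assumes "(f has_derivative D) (at x)"
  shows "h \<bullet> grad f x = D h"
proof -
  have "(f has_derivative (\<lambda>h. h \<bullet> grad f x)) (at x)"
    using assms by (intro has_derivative_grad) (auto simp: differentiable_def)
  then show ?thesis
    using has_derivative_unique[OF assms] by metis
qed

lemma has_derivative_hessian:
  assumes "Ck_on 2 S u" "q \<in> S"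
  shows "(grad u has_derivative hessian u q) (at q)"
proof -
  have "Ck_on (Suc 0) S (\<lambda>x. frechet_derivative u (at x) i)" for i
    using Ck_on_SucD(2)[of "Suc 0" S u] assms(1) by (simp only: numeral_2_eq_2)
  then have "(\<lambda>x. frechet_derivative u (at x) i) differentiable (at q)" for i
    using Ck_on_SucD(1)[of 0 S _ q] assms(2) differentiableI by blast
  then have "(\<lambda>x. frechet_derivative u (at x) i *\<^sub>R i) differentiable (at q)" for i
    by (intro differentiable_scaleR differentiable_const)
  then have "grad u differentiable (at q)"
    unfolding grad_def[abs_def] by (intro differentiable_sum) auto
  then show ?thesis
    by (simp add: hessian_def frechet_derivative_works)
qed

text \<open>The generator applied to \<open>exp V\<close> for \<open>V\<close> quadratic in the momentum, with gradient
  \<open>b p + w\<close> there; \<open>D\<close> is the derivative of \<open>V\<close> in the position.\<close>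

lemma langevin_generator_exp:
  fixes U :: "'a::euclidean_space \<Rightarrow> ennreal" and V :: "'a \<times> 'a \<Rightarrow> real"
  assumes D: "((\<lambda>q'. V (q', p)) has_derivative D) (at q)"
    and V: "\<And>p'. V (q, p') = v + b * (norm p')\<^sup>2 / 2 + p' \<bullet> w"
  shows "langevin_generator \<gamma> T U (\<lambda>z. exp (V z)) (q, p) =
    exp (V (q, p)) * (D p - grad (real_potential U) q \<bullet> (b *\<^sub>R p + w)
      - \<gamma> * (p \<bullet> (b *\<^sub>R p + w)) + \<gamma> * T * (b * DIM('a) + (norm (b *\<^sub>R p + w))\<^sup>2))"
proof -
  let ?W = "\<lambda>p'. exp (V (q, p'))"
  let ?m = "\<lambda>p'. b *\<^sub>R p' + w"
  have dW: "(?W has_derivative (\<lambda>h. ?W p' * (h \<bullet> ?m p'))) (at p')" for p'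
    unfolding V power2_norm_eq_inner
    by (auto intro!: derivative_eq_intros simp: inner_add_right inner_commute algebra_simps)
  have fd: "frechet_derivative ?W (at p') = (\<lambda>h. ?W p' * (h \<bullet> ?m p'))" for p'
    using frechet_derivative_at[OF dW] by metis
  have grad_p: "h \<bullet> grad ?W p = ?W p * (h \<bullet> ?m p)" for h
    using inner_grad[OF dW] .
  have grad_q: "p \<bullet> grad (\<lambda>q'. exp (V (q', p))) q = ?W p * D p"
    using inner_grad[OF has_derivative_exp[OF D]] by (simp add: mult.commute)
  \<comment> \<open>second derivative: \<open>?W (i \<bullet> ?m)\<close> is the first derivative in the direction \<open>i\<close>\<close>
  have d2W: "((\<lambda>y. ?W y * (i \<bullet> ?m y)) has_derivative
      (\<lambda>h. ?W p * (h \<bullet> ?m p) * (i \<bullet> ?m p) + ?W p * (b * (i \<bullet> h)))) (at p)" for i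
  proof -
    have "((\<lambda>y. i \<bullet> ?m y) has_derivative (\<lambda>h. b * (i \<bullet> h))) (at p)"
      by (auto intro!: derivative_eq_intros simp: inner_add_right)
    from has_derivative_mult[OF dW this] show ?thesis
      by (rule has_derivative_eq_rhs) (simp add: fun_eq_iff)
  qed
  have "laplacian ?W p =
      (\<Sum>i\<in>Basis. ?W p * (i \<bullet> ?m p) * (i \<bullet> ?m p) + ?W p * (b * (i \<bullet> i)))"
    unfolding laplacian_def fd
    by (rule sum.cong[OF refl]) (simp only: frechet_derivative_at[OF d2W, symmetric])
  also have "\<dots> = ?W p * ((\<Sum>i\<in>Basis. (?m p \<bullet> i) * (?m p \<bullet> i)) + b * DIM('a))"
    by (simp add: sum.distrib sum_distrib_left distrib_left inner_commute mult_ac)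
  also have "\<dots> = ?W p * (b * DIM('a) + (norm (?m p))\<^sup>2)"
    using euclidean_inner[of "?m p" "?m p"] by (simp add: power2_norm_eq_inner)
  finally show ?thesis
    by (simp add: langevin_generator_def grad_q grad_p algebra_simps)
qed

section \<open>The correction to the Hamiltonian\<close>

text \<open>The correction to \<open>b H\<close> in the exponent. Along the Hamiltonian flow it decreases at rate
  \<open>\<phi> (u q)\<close> up to small terms. The quotient is only relevant where \<open>\<phi> (u q)\<close> does not vanish.\<close>

definition corrector :: "(real \<Rightarrow> real) \<Rightarrow> ('a::euclidean_space \<Rightarrow> real) \<Rightarrow> 'a \<times> 'a \<Rightarrow> real" where
  "corrector \<phi> u = (\<lambda>(q, p). \<phi> (u q) * (p \<bullet> grad u q) / (norm (grad u q))\<^sup>2)"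

lemma has_derivative_corrector:
  fixes u :: "'a::euclidean_space \<Rightarrow> real"
  assumes u: "Ck_on 2 S u" "q \<in> S" and g: "grad u q \<noteq> 0"
    and \<phi>: "(\<phi> has_real_derivative c) (at (u q))"
  shows "\<exists>D. ((\<lambda>q'. corrector \<phi> u (q', p)) has_derivative D) (at q) \<and>
    \<bar>D p\<bar> \<le> (\<bar>c\<bar> + 3 * \<bar>\<phi> (u q)\<bar> * onorm (hessian u q) / (norm (grad u q))\<^sup>2) * (norm p)\<^sup>2"
proof -
  let ?g = "grad u q" and ?A = "hessian u q"
  define n where "n = norm ?g"
  have n: "n > 0" using g by (simp add: n_def)
  have gg: "?g \<bullet> ?g = n\<^sup>2" by (simp add: n_def power2_norm_eq_inner)
  have du: "(u has_derivative (\<lambda>h. h \<bullet> ?g)) (at q)"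
    using u by (intro has_derivative_grad) (simp add: numeral_2_eq_2)
  have dA: "(grad u has_derivative ?A) (at q)"
    by (rule has_derivative_hessian[OF u])
  have bl: "bounded_linear ?A" using dA by (rule has_derivative_bounded_linear)
  have d\<phi>: "((\<lambda>q'. \<phi> (u q')) has_derivative (\<lambda>h. c * (h \<bullet> ?g))) (at q)"
    using has_derivative_compose[OF du \<phi>[unfolded has_field_derivative_def]] .
  define D where "D h = c * (h \<bullet> ?g) * (p \<bullet> ?g) / n\<^sup>2
      + \<phi> (u q) * ((p \<bullet> ?A h) / n\<^sup>2 - 2 * (p \<bullet> ?g) * (?g \<bullet> ?A h) / n ^ 4)" for h
  have "((\<lambda>q'. corrector \<phi> u (q', p)) has_derivative D) (at q)"
    unfolding corrector_def prod.case power2_norm_eq_inner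
    by (rule has_derivative_eq_rhs,
        (rule has_derivative_divide has_derivative_mult d\<phi> has_derivative_inner has_derivative_const dA)+)
       (use g n in \<open>auto simp: D_def gg fun_eq_iff inner_commute field_simps power2_eq_square power4_eq_xxxx\<close>)
  moreover have "\<bar>D p\<bar> \<le> (\<bar>c\<bar> + 3 * \<bar>\<phi> (u q)\<bar> * onorm ?A / n\<^sup>2) * (norm p)\<^sup>2"
  proof -
    have pg: "\<bar>p \<bullet> ?g\<bar> \<le> norm p * n"
      unfolding n_def by (rule Cauchy_Schwarz_ineq2)
    have Ap: "norm (?A p) \<le> onorm ?A * norm p" by (rule onorm[OF bl])
    have pA: "\<bar>p \<bullet> ?A p\<bar> \<le> norm p * (onorm ?A * norm p)"
      using Cauchy_Schwarz_ineq2[of p "?A p"] Ap by (meson mult_left_mono norm_ge_zero order_trans)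
    have gA: "\<bar>?g \<bullet> ?A p\<bar> \<le> n * (onorm ?A * norm p)"
      unfolding n_def using Cauchy_Schwarz_ineq2[of ?g "?A p"] Ap
      by (meson mult_left_mono norm_ge_zero order_trans)
    have 1: "\<bar>c * (p \<bullet> ?g) * (p \<bullet> ?g) / n\<^sup>2\<bar> \<le> \<bar>c\<bar> * (norm p)\<^sup>2"
    proof -
      have "\<bar>p \<bullet> ?g\<bar> * \<bar>p \<bullet> ?g\<bar> \<le> (norm p * n) * (norm p * n)"
        using pg by (intro mult_mono) (use n in auto)
      then have "\<bar>c\<bar> * (\<bar>p \<bullet> ?g\<bar> * \<bar>p \<bullet> ?g\<bar>) \<le> \<bar>c\<bar> * ((norm p * n) * (norm p * n))"
        by (intro mult_left_mono) auto
      then show ?thesis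
        using n by (simp add: abs_mult field_simps power2_eq_square)
    qed
    have 2: "\<bar>(p \<bullet> ?A p) / n\<^sup>2\<bar> \<le> onorm ?A * (norm p)\<^sup>2 / n\<^sup>2"
      using pA n by (simp add: divide_right_mono power2_eq_square mult_ac)
    have 3: "\<bar>2 * (p \<bullet> ?g) * (?g \<bullet> ?A p) / n ^ 4\<bar> \<le> 2 * (onorm ?A * (norm p)\<^sup>2 / n\<^sup>2)"
    proof -
      have "\<bar>p \<bullet> ?g\<bar> * \<bar>?g \<bullet> ?A p\<bar> \<le> (norm p * n) * (n * (onorm ?A * norm p))"
        using pg gA by (intro mult_mono) (use n in auto)
      then have "\<bar>2 * (p \<bullet> ?g) * (?g \<bullet> ?A p) / n ^ 4\<bar>
          \<le> 2 * ((norm p * n) * (n * (onorm ?A * norm p))) / n ^ 4"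
        using n by (simp add: abs_mult divide_right_mono)
      also have "\<dots> = 2 * (onorm ?A * (norm p)\<^sup>2 / n\<^sup>2)"
        using n by (simp add: field_simps power2_eq_square power4_eq_xxxx)
      finally show ?thesis .
    qed
    have "\<bar>D p\<bar> \<le> \<bar>c\<bar> * (norm p)\<^sup>2 + \<bar>\<phi> (u q)\<bar> * (3 * (onorm ?A * (norm p)\<^sup>2 / n\<^sup>2))"
    proof -
      have "\<bar>(p \<bullet> ?A p) / n\<^sup>2 - 2 * (p \<bullet> ?g) * (?g \<bullet> ?A p) / n ^ 4\<bar>
          \<le> 3 * (onorm ?A * (norm p)\<^sup>2 / n\<^sup>2)"
        using 2 3 by linarith
      then have "\<bar>\<phi> (u q) * ((p \<bullet> ?A p) / n\<^sup>2 - 2 * (p \<bullet> ?g) * (?g \<bullet> ?A p) / n ^ 4)\<bar>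
          \<le> \<bar>\<phi> (u q)\<bar> * (3 * (onorm ?A * (norm p)\<^sup>2 / n\<^sup>2))"
        unfolding abs_mult by (intro mult_left_mono) auto
      with 1 show ?thesis unfolding D_def by linarith
    qed
    then show ?thesis by (simp add: algebra_simps)
  qed
  ultimately show ?thesis unfolding n_def by blast
qed

text \<open>Since \<open>R' < R\<close>, the two open sets where \<open>u > R'\<close> and where \<open>u < R\<close> cover \<open>S\<close>. The formula is
  smooth on the first, and the correction vanishes on the second.\<close>

lemma Ck_on_corrector:
  fixes u :: "'a::euclidean_space \<Rightarrow> real"
  assumes S: "open S" and u: "smooth_on S u" and \<phi>: "Ck_on k UNIV \<phi>"
    and R: "R' < R" "\<And>t. t \<le> R \<Longrightarrow> \<phi> t = 0"
    and g: "\<And>q. q \<in> S \<Longrightarrow> R' < u q \<Longrightarrow> grad u q \<noteq> 0"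
  shows "Ck_on k (S \<times> UNIV) (corrector \<phi> u)"
proof -
  have cont: "continuous_on S u"
    using u by (metis smooth_on_def Ck_on.simps(1))
  define A where "A = S \<inter> u -` {R'<..}"
  define B where "B = S \<inter> u -` {..<R}"
  have "open A" "open B"
    unfolding A_def B_def by (auto intro: continuous_open_preimage[OF cont S])
  then have op: "open (A \<times> (UNIV :: 'a set))" "open (B \<times> (UNIV :: 'a set))"
    by (auto intro: open_Times)
  have fst: "Ck_on k (A \<times> UNIV) (\<lambda>z::'a \<times> 'a. f (fst z))" if "Ck_on k S f" for f
    by (rule Ck_on_compose_linear[OF S op(1) bounded_linear_fst _ that]) (auto simp: A_def)
  have uk: "Ck_on k S u" and du: "\<And>i. Ck_on k S (\<lambda>q. frechet_derivative u (at q) i)"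
    using u Ck_on_SucD(2) unfolding smooth_on_def by blast+
  let ?f = "\<lambda>(z::'a \<times> 'a) i. frechet_derivative u (at (fst z)) i"
  have norm_eq: "(\<Sum>i\<in>Basis. ?f z i * ?f z i) = (norm (grad u (fst z)))\<^sup>2" for z
  proof -
    have "grad u (fst z) \<bullet> i = ?f z i" if "i \<in> Basis" for i
      using that by (simp add: grad_def)
    then show ?thesis
      unfolding power2_norm_eq_inner by (subst euclidean_inner) simp
  qed
  have "Ck_on k (A \<times> UNIV) (\<lambda>z. \<phi> (u (fst z)) * (\<Sum>i\<in>Basis. (snd z \<bullet> i) * ?f z i)
      * inverse (\<Sum>i\<in>Basis. ?f z i * ?f z i))"
  proof (intro Ck_on_mult op)
    show "Ck_on k (A \<times> UNIV) (\<lambda>z::'a \<times> 'a. \<phi> (u (fst z)))"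
      by (rule Ck_on_compose_real[OF op(1) open_UNIV _ \<phi> fst[OF uk]]) simp
    show "Ck_on k (A \<times> UNIV) (\<lambda>z. \<Sum>i\<in>Basis. (snd z \<bullet> i) * ?f z i)"
      by (intro Ck_on_sum Ck_on_mult op fst[OF du] Ck_on_linear
          bounded_linear_compose[OF bounded_linear_inner_left bounded_linear_snd])
    have "Ck_on k (A \<times> UNIV) (\<lambda>z. \<Sum>i\<in>Basis. ?f z i * ?f z i)"
      by (intro Ck_on_sum Ck_on_mult op fst[OF du])
    then show "Ck_on k (A \<times> UNIV) (\<lambda>z. inverse (\<Sum>i\<in>Basis. ?f z i * ?f z i))"
      by (rule Ck_on_compose_real[OF op(1) _ _ Ck_on_inverse, rotated 2])
         (use g in \<open>auto simp: norm_eq A_def\<close>)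
  qed
  moreover have "(\<Sum>i\<in>Basis. (snd z \<bullet> i) * ?f z i) = snd z \<bullet> grad u (fst z)" for z
    by (simp add: grad_def inner_sum_right mult.commute)
  ultimately have "Ck_on k (A \<times> UNIV) (corrector \<phi> u)"
    by (simp add: norm_eq corrector_def case_prod_beta' divide_inverse)
  moreover have "Ck_on k (B \<times> UNIV) (corrector \<phi> u)"
    using Ck_on_const[OF op(2), of k 0] R(2)
    by (subst Ck_on_cong[OF op(2), where g = "\<lambda>_. 0"]) (auto simp: corrector_def B_def)
  ultimately have "Ck_on k (A \<times> UNIV \<union> B \<times> UNIV) (corrector \<phi> u)"
    by (rule Ck_on_open_Un[OF op])
  then show ?thesis
    by (rule Ck_on_subset) (use R(1) in \<open>auto simp: A_def B_def\<close>)
qed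

lemma norm_scaled_inverse_le:
  fixes g :: "'a::real_normed_vector"
  assumes "\<bar>c\<bar> \<le> a" "c = 0 \<or> 1 / \<eta> \<le> norm (g)" "\<eta> > 0"
  shows "norm ((c / (norm (g))\<^sup>2) *\<^sub>R g) \<le> a * \<eta>"
proof (cases "c = 0")
  case True
  with assms show ?thesis by simp
next
  case False
  define n where "n = norm (g)"
  have n: "1 / \<eta> \<le> n" using assms False by (simp add: n_def)
  then have pos: "n > 0" using assms(3) by (smt (verit) divide_pos_pos)
  have "norm ((c / n\<^sup>2) *\<^sub>R g) = \<bar>c\<bar> * (1 / n)"
    using pos by (simp add: n_def[symmetric] power2_eq_square)
  also have "\<dots> \<le> a * \<eta>"
    using assms n pos by (intro mult_mono) (auto simp: field_simps)
  finally show ?thesis by (simp add: n_def)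
qed

text \<open>The condition on sequences, as a uniform bound above some level of the potential.\<close>

lemma admissible_potential_threshold:
  fixes U :: "'a::euclidean_space \<Rightarrow> ennreal"
  assumes "admissible_potential T U" "\<eta> > 0"
  obtains R where "R \<ge> 0"
    "\<And>q. q \<in> finite_domain U \<Longrightarrow> R \<le> real_potential U q \<Longrightarrow>
      1 / \<eta> \<le> norm (grad (real_potential U) q) \<and>
      onorm (hessian (real_potential U) q) \<le> \<eta> * (norm (grad (real_potential U) q))\<^sup>2"
proof -
  let ?u = "real_potential U"
  let ?P = "\<lambda>q. 1 / \<eta> \<le> norm (grad ?u q) \<and> onorm (hessian ?u q) \<le> \<eta> * (norm (grad ?u q))\<^sup>2"
  have "\<exists>k::nat. \<forall>q\<in>finite_domain U. real k \<le> ?u q \<longrightarrow> ?P q"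
  proof (rule ccontr)
    assume "\<not> ?thesis"
    then obtain x :: "nat \<Rightarrow> 'a" where x: "\<And>k. x k \<in> finite_domain U"
      "\<And>k. real k \<le> ?u (x k)" "\<And>k. \<not> ?P (x k)"
      by metis
    have "filterlim (\<lambda>k. ?u (x k)) at_top sequentially"
      by (rule filterlim_at_top_mono[OF filterlim_real_sequentially]) (simp add: x(2))
    moreover have "U (x k) = ennreal (?u (x k))" for k
      using x(1)[of k] by (simp add: finite_domain_def real_potential_def)
    ultimately have "(\<lambda>k. U (x k)) \<longlonglongrightarrow> \<infinity>"
      by (simp add: ennreal_tendsto_top_eq_at_top)
    then have lim: "filterlim (\<lambda>k. norm (grad ?u (x k))) at_top sequentially"
      "(\<lambda>k. onorm (hessian ?u (x k)) / (norm (grad ?u (x k)))\<^sup>2) \<longlonglongrightarrow> 0"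
      using assms(1) x(1) unfolding admissible_potential_def by blast+
    have "\<forall>\<^sub>F k in sequentially. 1 / \<eta> \<le> norm (grad ?u (x k))"
      using lim(1) by (simp add: filterlim_at_top)
    moreover have "\<forall>\<^sub>F k in sequentially.
        onorm (hessian ?u (x k)) / (norm (grad ?u (x k)))\<^sup>2 < \<eta>"
      using order_tendstoD(2)[OF lim(2) assms(2)] .
    ultimately have "\<forall>\<^sub>F k in sequentially. ?P (x k)"
    proof eventually_elim
      case (elim k)
      then have "norm (grad ?u (x k)) > 0"
        using assms(2) by (smt (verit) divide_pos_pos)
      with elim show ?case by (simp add: pos_divide_less_eq)
    qed
    then obtain k where "?P (x k)" by (auto simp: eventually_sequentially)
    with x(3) show False by blast
  qed
  then obtain k :: nat where "\<forall>q\<in>finite_domain U. real k \<le> ?u q \<longrightarrow> ?P q" by blast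
  then show ?thesis using that[of "real k"] by simp
qed

text \<open>The estimate of \<open>exp (- V)\<close> times the generator of \<open>exp V\<close>: here \<open>g\<close> is the gradient of the
  potential, \<open>d\<close> is the derivative of the correction along \<open>p\<close>, and \<open>w\<close> is the gradient of the
  correction in the momentum. The terms \<open>b (p \<bullet> g)\<close> cancel.\<close>

lemma drift_estimate:
  fixes p g w :: "'a::euclidean_space"
  assumes "\<gamma> > 0" "T > 0" "b > 0" "b * T < 1"
    and d: "d \<le> \<theta> * (norm p)\<^sup>2" and w: "norm w \<le> \<omega>"
    and 1: "\<theta> + \<gamma> * \<omega> \<le> \<gamma> * b * (1 - b * T) / 2" and 2: "\<gamma> * \<omega> + \<gamma> * T * \<omega>\<^sup>2 \<le> 1"
  shows "b * (p \<bullet> g) + d - g \<bullet> (b *\<^sub>R p + w) - \<gamma> * (p \<bullet> (b *\<^sub>R p + w))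
      + \<gamma> * T * (b * m + (norm (b *\<^sub>R p + w))\<^sup>2)
    \<le> - (\<gamma> * b * (1 - b * T) / 2) * (norm p)\<^sup>2 + \<gamma> * T * b * m + 1 - g \<bullet> w"
proof -
  define k s where "k = \<gamma> * b * (1 - b * T)" and "s = (norm p)\<^sup>2"
  have \<omega>: "\<omega> \<ge> 0" using w norm_ge_zero order_trans by blast
  have np: "norm p \<le> s + 1"
    using sum_squares_bound[of "norm p" 1] by (simp add: s_def power2_eq_square) (smt (verit) norm_ge_zero)
  have "\<bar>p \<bullet> w\<bar> \<le> norm p * norm w" by (rule Cauchy_Schwarz_ineq2)
  also have "\<dots> \<le> (s + 1) * \<omega>" using np w by (intro mult_mono) (auto simp: s_def)
  finally have pw: "\<bar>p \<bullet> w\<bar> \<le> (s + 1) * \<omega>" .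
  have "(2 * b * T - 1) * (p \<bullet> w) \<le> \<bar>2 * b * T - 1\<bar> * \<bar>p \<bullet> w\<bar>"
    by (metis abs_ge_self abs_mult)
  also have "\<dots> \<le> 1 * ((s + 1) * \<omega>)"
    using assms pw by (intro mult_mono) (auto simp: abs_le_iff)
  finally have "\<gamma> * ((2 * b * T - 1) * (p \<bullet> w)) \<le> \<gamma> * (1 * ((s + 1) * \<omega>))"
    using assms(1) by (intro mult_left_mono) auto
  then have A: "\<gamma> * ((2 * b * T - 1) * (p \<bullet> w)) \<le> \<gamma> * \<omega> * s + \<gamma> * \<omega>"
    by (simp add: algebra_simps)
  have "(norm w)\<^sup>2 \<le> \<omega>\<^sup>2" using w by (intro power_mono) auto
  then have B: "\<gamma> * T * (norm w)\<^sup>2 \<le> \<gamma> * T * \<omega>\<^sup>2"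
    using assms by (intro mult_left_mono) auto
  have C: "(\<theta> + \<gamma> * \<omega>) * s \<le> k / 2 * s"
    using 1 by (intro mult_right_mono) (auto simp: k_def s_def)
  have "b * (p \<bullet> g) + d - g \<bullet> (b *\<^sub>R p + w) - \<gamma> * (p \<bullet> (b *\<^sub>R p + w))
      + \<gamma> * T * (b * m + (norm (b *\<^sub>R p + w))\<^sup>2)
    = d - k * s + \<gamma> * ((2 * b * T - 1) * (p \<bullet> w)) + \<gamma> * T * (norm w)\<^sup>2 + \<gamma> * T * b * m - g \<bullet> w"
    unfolding k_def s_def power2_norm_eq_inner
    by (simp add: inner_add_left inner_add_right inner_commute algebra_simps power2_eq_square)
  also have "\<dots> \<le> - (k / 2) * s + \<gamma> * T * b * m + 1 - g \<bullet> w"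
    using A B C d 2 unfolding distrib_right s_def[symmetric] by simp
  finally show ?thesis by (simp add: k_def s_def)
qed

section \<open>Growth and regularity\<close>

lemma Ck_on_hamiltonian:
  fixes U :: "'a::euclidean_space \<Rightarrow> ennreal"
  assumes "open (finite_domain U)" "smooth_on (finite_domain U) (real_potential U)"
  shows "Ck_on k (state_space U) (hamiltonian U)"
proof -
  have op: "open (state_space U)"
    unfolding state_space_def by (intro open_Times assms(1) open_UNIV)
  have "Ck_on k (state_space U) (\<lambda>z::'a \<times> 'a. real_potential U (fst z))"
    by (rule Ck_on_compose_linear[OF assms(1) op bounded_linear_fst])
       (use assms(2) in \<open>auto simp: state_space_def smooth_on_def\<close>)
  moreover have "Ck_on k (state_space U) (\<lambda>z::'a \<times> 'a.
      (\<Sum>i\<in>Basis. (snd z \<bullet> i) * (snd z \<bullet> i)) * (1 / 2))"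
    by (intro Ck_on_mult Ck_on_sum Ck_on_const op Ck_on_linear
        bounded_linear_compose[OF bounded_linear_inner_left bounded_linear_snd])
  ultimately have "Ck_on k (state_space U) (\<lambda>z::'a \<times> 'a.
      (\<Sum>i\<in>Basis. (snd z \<bullet> i) * (snd z \<bullet> i)) * (1 / 2) + real_potential U (fst z))"
    by (intro Ck_on_add op)
  moreover have "(\<Sum>i\<in>Basis. (p \<bullet> i) * (p \<bullet> i)) = (norm p)\<^sup>2" for p :: 'a
    unfolding power2_norm_eq_inner by (rule euclidean_inner[symmetric])
  ultimately show ?thesis by (simp add: hamiltonian_def case_prod_beta')
qed

lemma norm_momentum_le_hamiltonian: "(norm (snd z))\<^sup>2 \<le> 2 * hamiltonian U z"
  by (cases z) (simp add: hamiltonian_def real_potential_def)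

text \<open>The momentum is at most of the order of the square root of the energy.\<close>

lemma momentum_negligible:
  assumes "\<epsilon> > 0" "2 / \<epsilon>\<^sup>2 \<le> hamiltonian U z"
  shows "norm (snd z) \<le> \<epsilon> * hamiltonian U z"
proof (rule power2_le_imp_le)
  have pos: "0 < hamiltonian U z"
    using assms by (smt (verit) divide_pos_pos zero_less_power)
  have "2 \<le> \<epsilon>\<^sup>2 * hamiltonian U z"
    using assms by (simp add: pos_divide_le_eq mult.commute)
  then have "2 * hamiltonian U z \<le> \<epsilon>\<^sup>2 * hamiltonian U z * hamiltonian U z"
    using pos by (intro mult_right_mono) auto
  with norm_momentum_le_hamiltonian[of z U]
  show "(norm (snd z))\<^sup>2 \<le> (\<epsilon> * hamiltonian U z)\<^sup>2"
    by (simp add: power_mult_distrib power2_eq_square[of "hamiltonian U z"] mult_ac)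
  show "0 \<le> \<epsilon> * hamiltonian U z" using pos assms by simp
qed

lemma filterlim_at_top_of_ln_growth:
  fixes H W :: "'a \<Rightarrow> real"
  assumes "b > 0" "\<And>z. z \<in> X \<Longrightarrow> W z > 0"
    and "\<And>\<epsilon>. \<epsilon> > 0 \<Longrightarrow> \<exists>R>0. \<forall>z\<in>X. H z \<ge> R \<longrightarrow> \<bar>ln (W z) - b * H z\<bar> \<le> \<epsilon> * H z"
  shows "filterlim W at_top (inf (filtercomap H at_top) (principal X))"
  unfolding filterlim_at_top_gt[where c = 0]
proof (intro allI impI)
  fix Z :: real
  assume Z: "Z > 0"
  obtain R where R: "\<forall>z\<in>X. H z \<ge> R \<longrightarrow> \<bar>ln (W z) - b * H z\<bar> \<le> (b / 2) * H z"
    using assms(3)[of "b / 2"] assms(1) by auto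
  have "Z \<le> W z" if "z \<in> X" "H z \<ge> max R (2 * ln Z / b)" for z
  proof -
    have "ln Z \<le> (b / 2) * H z"
      using that(2) assms(1) by (simp add: field_simps)
    also have "\<dots> \<le> ln (W z)"
    proof -
      have "\<bar>ln (W z) - b * H z\<bar> \<le> (b / 2) * H z"
        using R that by auto
      then show ?thesis by linarith
    qed
    finally show ?thesis using Z assms(2)[OF that(1)] by simp
  qed
  then show "\<forall>\<^sub>F z in inf (filtercomap H at_top) (principal X). Z \<le> W z"
    unfolding eventually_inf_principal eventually_filtercomap_at_top_linorder by blast
qed

section \<open>The Lyapunov function\<close>

text \<open>The construction works in every Euclidean space of positions; the drift constant is \<open>1\<close>.\<close>

lemma langevin_lyapunov_function:
  fixes U :: "'a::euclidean_space \<Rightarrow> ennreal" and \<gamma> T b :: real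
  assumes \<gamma>: "\<gamma> > 0" and T: "T > 0" and U: "admissible_potential T U"
    and b: "0 < b" "b < 1 / T"
  shows "\<exists>W :: 'a \<times> 'a \<Rightarrow> real.
      smooth_on (state_space U) W \<and> (\<forall>z\<in>state_space U. W z > 0) \<and>
      (\<forall>\<epsilon>>0. \<exists>R>0. \<forall>z\<in>state_space U. hamiltonian U z \<ge> R \<longrightarrow>
         \<bar>ln (W z) - b * hamiltonian U z\<bar> \<le> \<epsilon> * hamiltonian U z) \<and>
      filterlim W at_top (inf (filtercomap (hamiltonian U) at_top) (principal (state_space U))) \<and>
      (\<exists>c>0. \<exists>K>0. \<forall>z\<in>state_space U. langevin_generator \<gamma> T U W z \<le> - c * W z + K)"
proof -
  define u where "u = real_potential U"
  define S where "S = finite_domain U"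
  have S: "open S" and smooth: "smooth_on S u"
    using U by (auto simp: admissible_potential_def u_def S_def)
  have C2: "Ck_on 2 S u" using smooth by (simp add: smooth_on_def)
  have bT: "b * T < 1" using b T by (simp add: pos_less_divide_eq)

  \<comment> \<open>The limit \<open>\<alpha>\<close> of the cutoff is twice the height \<open>A + 2\<close> which it must reach, \<open>\<delta>\<close> makes its slope
    at most \<open>\<kappa> / 4\<close>, and \<open>\<omega>\<close> bounds the momentum gradient of the correction.\<close>
  define \<kappa> where "\<kappa> = \<gamma> * b * (1 - b * T)"
  define A where "A = \<gamma> * T * b * DIM('a)"
  define \<alpha> where "\<alpha> = 2 * (A + 2)"
  define \<delta> where "\<delta> = \<kappa> / (8 * \<alpha>)"
  define \<omega> where "\<omega> = min 1 (min (1 / (\<gamma> + \<gamma> * T)) (\<kappa> / (4 * (3 + \<gamma>))))"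
  define \<eta> where "\<eta> = \<omega> / \<alpha>"
  have \<kappa>: "\<kappa> > 0" using \<gamma> b bT by (simp add: \<kappa>_def)
  have A: "A \<ge> 0" using \<gamma> T b by (simp add: A_def)
  then have \<alpha>: "\<alpha> > 0" by (simp add: \<alpha>_def)
  have \<delta>: "\<delta> > 0" using \<kappa> \<alpha> by (simp add: \<delta>_def)
  have \<omega>: "\<omega> > 0" using \<kappa> \<gamma> T by (simp add: \<omega>_def add_pos_pos)
  have \<omega>_le: "\<omega> \<le> 1" "\<omega> \<le> 1 / (\<gamma> + \<gamma> * T)" "\<omega> \<le> \<kappa> / (4 * (3 + \<gamma>))"
    by (auto simp: \<omega>_def)
  have \<eta>: "\<eta> > 0" and \<alpha>\<eta>: "\<alpha> * \<eta> = \<omega>" using \<omega> \<alpha> by (auto simp: \<eta>_def)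
  have small1: "(\<kappa> / 4 + 3 * \<omega>) + \<gamma> * \<omega> \<le> \<gamma> * b * (1 - b * T) / 2"
  proof -
    have "\<omega> * (4 * (3 + \<gamma>)) \<le> \<kappa>"
      using \<omega>_le(3) \<gamma> by (subst (asm) pos_le_divide_eq) auto
    then show ?thesis unfolding \<kappa>_def[symmetric] by (simp add: algebra_simps)
  qed
  have small2: "\<gamma> * \<omega> + \<gamma> * T * \<omega>\<^sup>2 \<le> 1"
  proof -
    have "\<omega> * \<omega> \<le> \<omega> * 1" using \<omega> \<omega>_le(1) by (intro mult_left_mono) auto
    then have "\<gamma> * T * \<omega>\<^sup>2 \<le> \<gamma> * T * \<omega>"
      using \<gamma> T by (intro mult_left_mono) (auto simp: power2_eq_square)
    moreover have "\<omega> * (\<gamma> + \<gamma> * T) \<le> 1"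
      using \<omega>_le(2) \<gamma> T by (subst (asm) pos_le_divide_eq) (auto simp: add_pos_pos)
    ultimately show ?thesis by (simp add: algebra_simps)
  qed

  obtain R0 where R0: "\<And>q. q \<in> S \<Longrightarrow> R0 \<le> u q \<Longrightarrow>
      1 / \<eta> \<le> norm (grad u q) \<and> onorm (hessian u q) \<le> \<eta> * (norm (grad u q))\<^sup>2"
    using admissible_potential_threshold[OF U \<eta>] unfolding u_def S_def by metis
  \<comment> \<open>The cutoff starts strictly above \<open>R0\<close>, so that the sets \<open>u > R0\<close> and \<open>u < R\<close> are open and cover
    the domain: on the first \<open>grad u\<close> has no zeros, on the second the correction vanishes.\<close>
  define R where "R = R0 + 1"
  have g0: "grad u q \<noteq> 0" if "q \<in> S" "R0 \<le> u q" for q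
    using R0[OF that] \<eta> by (auto simp: divide_le_0_iff)

  define \<phi> where "\<phi> t = \<alpha> * flat 0 (\<delta> * (t - R))" for t
  define \<phi>' where "\<phi>' t = \<alpha> * (flat 2 (\<delta> * (t - R)) * \<delta>)" for t
  have \<phi>_0: "\<phi> t = 0" if "t \<le> R" for t
    using that \<delta> by (simp add: \<phi>_def flat_def mult_le_0_iff not_less[symmetric] zero_less_mult_iff)
  have \<phi>_bounds: "0 \<le> \<phi> t" "\<phi> t \<le> \<alpha>" for t
  proof -
    have "flat 0 s \<le> 1" for s by (simp add: flat_def)
    then have "\<alpha> * flat 0 (\<delta> * (t - R)) \<le> \<alpha> * 1" using \<alpha> by (intro mult_left_mono) auto
    then show "\<phi> t \<le> \<alpha>" by (simp add: \<phi>_def)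
  qed (use \<alpha> flat_nonneg in \<open>simp add: \<phi>_def\<close>)
  have D\<phi>: "(\<phi> has_real_derivative \<phi>' t) (at t)" for t
  proof -
    have "((\<lambda>t. \<delta> * (t - R)) has_real_derivative \<delta>) (at t)"
      by (auto intro!: derivative_eq_intros)
    from DERIV_cmult[OF DERIV_chain2[OF DERIV_flat[of 0] this]] show ?thesis
      unfolding \<phi>_def[abs_def] \<phi>'_def by (simp add: numeral_2_eq_2)
  qed
  have \<phi>'_le: "\<bar>\<phi>' t\<bar> \<le> \<kappa> / 4" for t
  proof -
    have "flat 2 s \<le> 2" for s
      using flat_le[of s 2 0] by (cases "s \<ge> 0") (auto simp: flat_def)
    then have "\<alpha> * (flat 2 (\<delta> * (t - R)) * \<delta>) \<le> \<alpha> * (2 * \<delta>)"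
      using \<alpha> \<delta> by (intro mult_left_mono mult_right_mono) auto
    then have "\<phi>' t \<le> \<alpha> * (2 * \<delta>)" by (simp only: \<phi>'_def)
    also have "\<dots> = \<kappa> / 4" using \<alpha> by (simp add: \<delta>_def)
    finally have "\<phi>' t \<le> \<kappa> / 4" .
    moreover have "0 \<le> \<phi>' t"
      unfolding \<phi>'_def using \<alpha> \<delta> by (intro mult_nonneg_nonneg flat_nonneg) auto
    ultimately show ?thesis by simp
  qed
  have \<phi>_large: "A + 2 \<le> \<phi> t" if "R + 2 / \<delta> \<le> t" for t
  proof -
    define s where "s = \<delta> * (t - R)"
    have s: "s \<ge> 2" using that \<delta> by (simp add: s_def field_simps)
    have "1 / 2 \<le> 1 + - inverse s"
      using s by (simp add: inverse_eq_divide field_simps)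
    also have "\<dots> \<le> flat 0 s"
      using s exp_ge_add_one_self[of "- inverse s"] by (simp add: flat_def)
    finally have "\<alpha> * (1 / 2) \<le> \<alpha> * flat 0 s"
      using \<alpha> by (intro mult_left_mono) auto
    then show ?thesis
      by (simp add: \<phi>_def s_def[symmetric]) (simp add: \<alpha>_def)
  qed
  have \<phi>_smooth: "Ck_on k UNIV \<phi>" for k
  proof -
    have "Ck_on k UNIV (\<lambda>t. \<delta> * (t + - R))"
      by (intro Ck_on_mult Ck_on_add Ck_on_const Ck_on_linear bounded_linear_ident open_UNIV)
    then have "Ck_on k UNIV (\<lambda>t. flat 0 (\<delta> * (t + - R)))"
      by (rule Ck_on_compose_real[OF open_UNIV open_UNIV UNIV_I Ck_on_flat])
    then show ?thesis
      unfolding \<phi>_def[abs_def] by (intro Ck_on_mult Ck_on_const open_UNIV) simp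
  qed

  \<comment> \<open>\<open>w q\<close> is the gradient of the correction in the momentum.\<close>
  define w where "w q = (\<phi> (u q) / (norm (grad u q))\<^sup>2) *\<^sub>R grad u q" for q
  define V where "V z = b * hamiltonian U z + corrector \<phi> u z" for z
  have \<phi>_cases: "\<phi> (u q) = 0 \<or> 1 / \<eta> \<le> norm (grad u q)" if "q \<in> S" for q
    using R0[OF that] \<phi>_0[of "u q"] by (cases "u q \<le> R") (auto simp: R_def)
  have norm_w: "norm (w q) \<le> \<omega>" if "q \<in> S" for q
    unfolding w_def \<alpha>\<eta>[symmetric]
    by (rule norm_scaled_inverse_le[OF _ \<phi>_cases[OF that] \<eta>]) (use \<phi>_bounds in \<open>simp add: abs_of_nonneg\<close>)
  have g_w: "grad u q \<bullet> w q = \<phi> (u q)" if "q \<in> S" for q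
    using \<phi>_cases[OF that] \<eta> by (auto simp: w_def power2_norm_eq_inner)
  have corr: "corrector \<phi> u (q, p) = p \<bullet> w q" for q p
    by (simp add: corrector_def w_def)
  have corr_le: "\<bar>corrector \<phi> u z\<bar> \<le> norm (snd z)" if "z \<in> state_space U" for z
  proof -
    obtain q p where z: "z = (q, p)" by force
    then have "norm p * norm (w q) \<le> norm p * 1"
      using that norm_w[of q] \<omega>_le(1) by (intro mult_left_mono) (auto simp: state_space_def S_def)
    then show ?thesis
      using Cauchy_Schwarz_ineq2[of p "w q"] by (simp add: z corr)
  qed

  have drift: "langevin_generator \<gamma> T U (\<lambda>z. exp (V z)) (q, p)
      \<le> exp (V (q, p)) * (- (\<kappa> / 2) * (norm p)\<^sup>2 + A + 1 - \<phi> (u q))" if q: "q \<in> S" for q p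
  proof -
    have "\<exists>D. ((\<lambda>q'. corrector \<phi> u (q', p)) has_derivative D) (at q) \<and>
        \<bar>D p\<bar> \<le> (\<kappa> / 4 + 3 * \<omega>) * (norm p)\<^sup>2"
    proof (cases "R0 \<le> u q")
      case True
      let ?n = "norm (grad u q)"
      have "onorm (hessian u q) / ?n\<^sup>2 \<le> \<eta>"
        using R0[OF q True] g0[OF q True] by (simp add: pos_divide_le_eq)
      then have "3 * \<bar>\<phi> (u q)\<bar> * (onorm (hessian u q) / ?n\<^sup>2) \<le> 3 * \<bar>\<phi> (u q)\<bar> * \<eta>"
        by (intro mult_left_mono) auto
      also have "\<dots> \<le> 3 * \<alpha> * \<eta>"
        using \<phi>_bounds[of "u q"] \<eta> by (intro mult_right_mono) auto
      finally have "\<bar>\<phi>' (u q)\<bar> + 3 * \<bar>\<phi> (u q)\<bar> * onorm (hessian u q) / ?n\<^sup>2 \<le> \<kappa> / 4 + 3 * \<omega>"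
        using \<phi>'_le[of "u q"] \<alpha>\<eta> by simp
      then have "(\<bar>\<phi>' (u q)\<bar> + 3 * \<bar>\<phi> (u q)\<bar> * onorm (hessian u q) / ?n\<^sup>2) * (norm p)\<^sup>2
          \<le> (\<kappa> / 4 + 3 * \<omega>) * (norm p)\<^sup>2"
        by (intro mult_right_mono) auto
      with has_derivative_corrector[OF C2 q g0[OF q True] D\<phi>, of p] show ?thesis
        using order_trans by blast
    next
      case False
      have "continuous_on S u" using smooth by (metis smooth_on_def Ck_on.simps(1))
      then have "open (S \<inter> u -` {..<R})"
        by (intro continuous_open_preimage S) auto
      moreover have "q \<in> S \<inter> u -` {..<R}" using False q by (simp add: R_def)
      ultimately have "((\<lambda>q'. corrector \<phi> u (q', p)) has_derivative (\<lambda>_. 0)) (at q)"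
        by (rule has_derivative_transform_within_open[OF has_derivative_const])
           (simp add: corrector_def \<phi>_0)
      then show ?thesis using \<kappa> \<omega> by (intro exI[of _ "\<lambda>_. 0"]) simp
    qed
    then obtain D where D: "((\<lambda>q'. corrector \<phi> u (q', p)) has_derivative D) (at q)"
      and D_le: "\<bar>D p\<bar> \<le> (\<kappa> / 4 + 3 * \<omega>) * (norm p)\<^sup>2" by blast
    have du: "(u has_derivative (\<lambda>h. h \<bullet> grad u q)) (at q)"
      using C2 q by (intro has_derivative_grad) (simp add: numeral_2_eq_2)
    have DV: "((\<lambda>q'. V (q', p)) has_derivative (\<lambda>h. b * (h \<bullet> grad u q) + D h)) (at q)"
      unfolding V_def hamiltonian_def prod.case u_def[symmetric]
      by (auto intro!: derivative_eq_intros du D)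
    have Vp: "V (q, p') = b * u q + b * (norm p')\<^sup>2 / 2 + p' \<bullet> w q" for p'
      by (simp add: V_def hamiltonian_def corr u_def[symmetric] algebra_simps)
    have "b * (p \<bullet> grad u q) + D p - grad u q \<bullet> (b *\<^sub>R p + w q) - \<gamma> * (p \<bullet> (b *\<^sub>R p + w q))
        + \<gamma> * T * (b * DIM('a) + (norm (b *\<^sub>R p + w q))\<^sup>2)
      \<le> - (\<gamma> * b * (1 - b * T) / 2) * (norm p)\<^sup>2 + \<gamma> * T * b * DIM('a) + 1 - grad u q \<bullet> w q"
      by (rule drift_estimate[OF \<gamma> T b(1) bT _ norm_w[OF q] small1 small2])
         (use D_le in simp)
    then show ?thesis
      unfolding langevin_generator_exp[OF DV Vp] u_def[symmetric]
      by (intro mult_left_mono) (auto simp: \<kappa>_def A_def g_w[OF q])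
  qed

  \<comment> \<open>\<open>P\<close> is the value of \<open>|p|\<^sup>2\<close> from which friction alone yields the drift, and \<open>M\<close> bounds \<open>exp V\<close> on
    the remaining set of small momenta and low potential.\<close>
  define P where "P = 2 * (A + 2) / \<kappa>"
  define M where "M = exp (b * (P / 2 + (R + 2 / \<delta>)) + (P + 1))"
  have lyap: "langevin_generator \<gamma> T U (\<lambda>z. exp (V z)) z \<le> - 1 * exp (V z) + (A + 2) * M"
    if "z \<in> state_space U" for z
  proof -
    obtain q p where z: "z = (q, p)" by force
    with that have q: "q \<in> S" by (simp add: state_space_def S_def)
    let ?r = "- (\<kappa> / 2) * (norm p)\<^sup>2 + A + 1 - \<phi> (u q)"
    have M: "0 \<le> (A + 2) * M" using A by (simp add: M_def)
    show ?thesis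
    proof (cases "R + 2 / \<delta> \<le> u q \<or> P \<le> (norm p)\<^sup>2")
      case True
      have "?r \<le> - 1"
      proof (cases "R + 2 / \<delta> \<le> u q")
        case True
        have "0 \<le> \<kappa> / 2 * (norm p)\<^sup>2" using \<kappa> by simp
        with \<phi>_large[OF True] show ?thesis by linarith
      next
        case False
        with \<open>R + 2 / \<delta> \<le> u q \<or> P \<le> (norm p)\<^sup>2\<close> have "\<kappa> / 2 * P \<le> \<kappa> / 2 * (norm p)\<^sup>2"
          using \<kappa> by (intro mult_left_mono) auto
        moreover have "\<kappa> / 2 * P = A + 2" using \<kappa> by (simp add: P_def)
        ultimately show ?thesis using \<phi>_bounds(1)[of "u q"] by linarith
      qed
      then have "exp (V (q, p)) * ?r \<le> exp (V (q, p)) * (- 1)"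
        by (intro mult_left_mono) auto
      with drift[OF q, of p] M show ?thesis by (simp add: z)
    next
      case False
      have "norm p \<le> P + 1"
        using False sum_squares_bound[of "norm p" 1] by (simp add: power2_eq_square) (smt (verit) norm_ge_zero)
      then have "corrector \<phi> u (q, p) \<le> P + 1"
        using corr_le[OF that] by (simp add: z abs_le_iff)
      moreover have "b * hamiltonian U (q, p) \<le> b * (P / 2 + (R + 2 / \<delta>))"
        using False b(1) by (intro mult_left_mono) (auto simp: hamiltonian_def u_def)
      ultimately have "exp (V (q, p)) \<le> M" by (simp add: V_def M_def)
      then have "(A + 2) * exp (V (q, p)) \<le> (A + 2) * M"
        using A by (intro mult_left_mono) auto
      moreover have "?r \<le> A + 1"
      proof -
        have "0 \<le> \<kappa> / 2 * (norm p)\<^sup>2" using \<kappa> by simp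
        with \<phi>_bounds(1)[of "u q"] show ?thesis by linarith
      qed
      then have "exp (V (q, p)) * ?r \<le> exp (V (q, p)) * (A + 1)"
        by (intro mult_left_mono) auto
      ultimately show ?thesis using drift[OF q, of p] by (simp add: z algebra_simps)
    qed
  qed

  have growth: "\<exists>R>0. \<forall>z\<in>state_space U. hamiltonian U z \<ge> R \<longrightarrow>
      \<bar>ln (exp (V z)) - b * hamiltonian U z\<bar> \<le> \<epsilon> * hamiltonian U z" if "\<epsilon> > 0" for \<epsilon>
  proof (intro exI[of _ "2 / \<epsilon>\<^sup>2"] conjI ballI impI)
    fix z assume z: "z \<in> state_space U" "2 / \<epsilon>\<^sup>2 \<le> hamiltonian U z"
    show "\<bar>ln (exp (V z)) - b * hamiltonian U z\<bar> \<le> \<epsilon> * hamiltonian U z"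
      using corr_le[OF z(1)] momentum_negligible[OF that z(2)] by (simp add: V_def)
  qed (use that in simp)

  have "Ck_on k (state_space U) V" for k
  proof -
    have op: "open (state_space U)"
      unfolding state_space_def by (intro open_Times open_UNIV) (use S S_def in simp)
    have "Ck_on k (state_space U) (corrector \<phi> u)"
      unfolding state_space_def S_def[symmetric]
      by (rule Ck_on_corrector[where R' = R0 and R = R, OF S smooth \<phi>_smooth _ \<phi>_0 g0])
         (auto simp: R_def)
    moreover have "Ck_on k (state_space U) (hamiltonian U)"
      by (rule Ck_on_hamiltonian) (use S smooth in \<open>auto simp: S_def u_def\<close>)
    ultimately show ?thesis
      unfolding V_def[abs_def] by (intro Ck_on_add Ck_on_mult Ck_on_const op)
  qed
  then have "smooth_on (state_space U) (\<lambda>z. exp (V z))"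
    unfolding smooth_on_def
    by (intro allI Ck_on_compose_real[OF _ open_UNIV UNIV_I Ck_on_exp])
       (use S in \<open>auto simp: state_space_def S_def intro: open_Times\<close>)
  moreover have "filterlim (\<lambda>z. exp (V z)) at_top
      (inf (filtercomap (hamiltonian U) at_top) (principal (state_space U)))"
    using filterlim_at_top_of_ln_growth[OF b(1) _ growth] by simp
  moreover have "(A + 2) * M > 0" using A by (simp add: M_def)
  then have "\<exists>c>0. \<exists>K>0. \<forall>z\<in>state_space U.
      langevin_generator \<gamma> T U (\<lambda>z. exp (V z)) z \<le> - c * exp (V z) + K"
    using lyap zero_less_one by blast
  ultimately show ?thesis
    using growth by (intro exI[of _ "\<lambda>z. exp (V z)"]) simp
qed

theorem proposition5p1:
  fixes U :: "real ^ 'd ^ 'n \<Rightarrow> ennreal" and \<gamma> T b :: real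
  assumes "\<gamma> > 0" and "T > 0"
    and "admissible_potential T U"
    and "0 < b" and "b < 1 / T"
  shows "\<exists>W :: (real ^ 'd ^ 'n) \<times> (real ^ 'd ^ 'n) \<Rightarrow> real.
      smooth_on (state_space U) W \<and> (\<forall>z\<in>state_space U. W z > 0) \<and>
      (\<forall>\<epsilon>>0. \<exists>R>0. \<forall>z\<in>state_space U. hamiltonian U z \<ge> R \<longrightarrow>
         \<bar>ln (W z) - b * hamiltonian U z\<bar> \<le> \<epsilon> * hamiltonian U z) \<and>
      filterlim W at_top (inf (filtercomap (hamiltonian U) at_top) (principal (state_space U))) \<and>
      (\<exists>c>0. \<exists>K>0. \<forall>z\<in>state_space U. langevin_generator \<gamma> T U W z \<le> - c * W z + K)"
  using langevin_lyapunov_function[OF assms] .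

end
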